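(* For all integers $m,n\ge 1$, the set of clonoids with source set $\{0,\dots,m\}$ and target $\{0,\dots,n\}$ (the set $\{0,\dots,n\}$ regarded as an algebra with no operations) has the cardinality of the continuum.
   Context: $\mathbb{N}=\{1,2,\dots\}$ and $[k]=\{1,\dots,k\}$. Minors: for sets $A,B$, a function $f\colon A^k\to B$, $\ell\in\mathbb{N}$ and $\sigma\colon[k]\to[\ell]$, the function $f^\sigma\colon A^\ell\to B$, $(x_1,\dots,x_\ell)\mapsto f(x_{\sigma(1)},\dots,x_{\sigma(k)})$ is a minor of $f$. A clonoid with source set $A$ and target the set $B$ (i.e. target algebra $(B,\emptyset)$ with no operations) is a subset $C\subseteq\bigcup_{k\in\mathbb{N}}B^{A^k}$ that is closed under taking minors. *)

theory Defs
  imports Complex_Main "HOL-Library.FuncSet" "HOL-Library.Equipollence"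
begin

text \<open>
  Tuples of length \<open>k\<close> over \<open>A\<close> are the extensional functions from \<open>{1..k}\<close> to \<open>A\<close>.
\<close>

definition tuples :: "'a set \<Rightarrow> nat \<Rightarrow> (nat \<Rightarrow> 'a) set" where
  "tuples A k = {1..k} \<rightarrow>\<^sub>E A"

text \<open>
  An extensional function does not determine its domain, because \<open>undefined\<close> may lie in \<open>B\<close>.
  Operations therefore carry their arity. For nonempty \<open>A\<close> the sets of functions
  from \<open>tuples A k\<close> to \<open>B\<close> are pairwise disjoint in set theory, so this is the same as their union.
\<close>

definition operations :: "'a set \<Rightarrow> 'b set \<Rightarrow> (nat \<times> ((nat \<Rightarrow> 'a) \<Rightarrow> 'b)) set" where
  "operations A B = (SIGMA k:{1..}. tuples A k \<rightarrow>\<^sub>E B)"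

text \<open>
  The tuple \<open>compose {1..k} x \<sigma>\<close> is \<open>(x (\<sigma> 1), \<dots>, x (\<sigma> k))\<close>.
\<close>

definition minor ::
    "'a set \<Rightarrow> nat \<Rightarrow> nat \<Rightarrow> (nat \<Rightarrow> nat) \<Rightarrow> ((nat \<Rightarrow> 'a) \<Rightarrow> 'b) \<Rightarrow> (nat \<Rightarrow> 'a) \<Rightarrow> 'b" where
  "minor A k l \<sigma> f = (\<lambda>x\<in>tuples A l. f (compose {1..k} x \<sigma>))"

definition clonoid :: "'a set \<Rightarrow> 'b set \<Rightarrow> (nat \<times> ((nat \<Rightarrow> 'a) \<Rightarrow> 'b)) set \<Rightarrow> bool" where
  "clonoid A B C \<longleftrightarrow>
     C \<subseteq> operations A B \<and>
     (\<forall>k f l \<sigma>. (k, f) \<in> C \<longrightarrow> l \<ge> 1 \<longrightarrow> \<sigma> \<in> {1..k} \<rightarrow> {1..l} \<longrightarrow> (l, minor A k l \<sigma> f) \<in> C)"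

end

theory Submission
  imports Defs "HOL-Analysis.Abstract_Topology_2"
begin

text \<open>
  There are only countably many operations, hence at most continuum many clonoids. Conversely, let
  \<open>f\<^sub>k\<close> be the indicator of the tuples of length \<open>k\<close> with exactly one entry \<open>a\<close>
  and all other entries \<open>b\<close>. If \<open>f\<^sub>l\<close> is the minor of \<open>f\<^sub>k\<close> along \<open>\<sigma>\<close>, then evaluating at the
  \<open>l\<close> tuples in the support of \<open>f\<^sub>l\<close> shows that every fibre of \<open>\<sigma>\<close> is a singleton,
  so \<open>k = l\<close>. Thus no \<open>f\<^sub>k\<close> is a minor of another one, and distinct sets of indices
  generate distinct clonoids.
\<close>

lemma compose_in_tuples:
  assumes "x \<in> tuples A l" and "\<sigma> \<in> {1..k} \<rightarrow> {1..l}"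
  shows "compose {1..k} x \<sigma> \<in> tuples A k"
  using assms by (auto simp: tuples_def compose_def PiE_iff Pi_iff)

lemma minor_in_operations:
  assumes "(k, f) \<in> operations A B" and "l \<ge> 1" and "\<sigma> \<in> {1..k} \<rightarrow> {1..l}"
  shows "(l, minor A k l \<sigma> f) \<in> operations A B"
proof -
  have "f (compose {1..k} x \<sigma>) \<in> B" if "x \<in> tuples A l" for x
    using assms(1) compose_in_tuples[OF that assms(3)] by (auto simp: operations_def)
  then show ?thesis
    using assms(2) by (auto simp: operations_def minor_def)
qed

text \<open>Both sides evaluate \<open>f\<close> at \<open>x\<close> composed with
  \<open>\<tau>\<close> and then \<open>\<sigma>\<close>. The ranges of \<open>\<sigma>\<close> and
  \<open>\<tau>\<close> ensure that no restriction on the left yields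
  \<open>undefined\<close>.\<close>

lemma minor_minor:
  fixes A :: "'a set"
  assumes "\<sigma> \<in> {1..k} \<rightarrow> {1..l}" and "\<tau> \<in> {1..l} \<rightarrow> {1..p}"
  shows "minor A l p \<tau> (minor A k l \<sigma> f) = minor A k p (\<tau> \<circ> \<sigma>) f"
proof -
  have "compose {1..k} (compose {1..l} x \<tau>) \<sigma> = compose {1..k} x (\<tau> \<circ> \<sigma>)" for x :: "nat \<Rightarrow> 'a"
    using assms(1) by (auto simp: compose_def fun_eq_iff Pi_iff)
  then show ?thesis
    using compose_in_tuples[OF _ assms(2), of _ A] by (simp add: minor_def cong: restrict_cong)
qed

lemma minor_id:
  assumes "(k, f) \<in> operations A B"
  shows "minor A k k id f = f"
proof -
  have "compose {1..k} x id = x" if "x \<in> tuples A k" for x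
    using that by (auto simp: compose_def tuples_def fun_eq_iff PiE_def extensional_def)
  then show ?thesis
    using assms by (simp add: minor_def operations_def PiE_def extensional_restrict cong: restrict_cong)
qed

text \<open>For a set \<open>F\<close> of operations this is the clonoid generated by
  \<open>F\<close>: a minor of a minor is a minor, so one step suffices, and
  \<open>\<sigma> = id\<close> gives back \<open>F\<close> itself.\<close>

definition minors ::
    "'a set \<Rightarrow> (nat \<times> ((nat \<Rightarrow> 'a) \<Rightarrow> 'b)) set \<Rightarrow> (nat \<times> ((nat \<Rightarrow> 'a) \<Rightarrow> 'b)) set" where
  "minors A F =
     {(l, minor A k l \<sigma> f) |k f l \<sigma>. (k, f) \<in> F \<and> l \<ge> 1 \<and> \<sigma> \<in> {1..k} \<rightarrow> {1..l}}"

lemma clonoid_minors: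
  assumes "F \<subseteq> operations A B"
  shows "clonoid A B (minors A F)"
  unfolding clonoid_def
proof (intro conjI allI impI)
  show "minors A F \<subseteq> operations A B"
    using assms minor_in_operations by (fastforce simp: minors_def)
next
  fix l p :: nat and g \<tau>
  assume g: "(l, g) \<in> minors A F" and p: "p \<ge> 1" and \<tau>: "\<tau> \<in> {1..l} \<rightarrow> {1..p}"
  from g obtain k f \<sigma> where f: "(k, f) \<in> F" and \<sigma>: "\<sigma> \<in> {1..k} \<rightarrow> {1..l}"
    and eq: "g = minor A k l \<sigma> f"
    by (auto simp: minors_def)
  have "\<tau> \<circ> \<sigma> \<in> {1..k} \<rightarrow> {1..p}"
    using \<sigma> \<tau> by (auto simp: Pi_iff)
  then show "(p, minor A l p \<tau> g) \<in> minors A F"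
    unfolding eq minor_minor[OF \<sigma> \<tau>] using f p by (auto simp: minors_def)
qed

text \<open>Each single arity admits only finitely many operations.\<close>

lemma countable_operations:
  assumes "finite A" and "finite B"
  shows "countable (operations A B)"
proof -
  have "countable (tuples A k \<rightarrow>\<^sub>E B)" for k
    using assms unfolding tuples_def by (intro countable_finite finite_PiE) auto
  then show ?thesis
    unfolding operations_def by (intro countable_SIGMA) auto
qed

definition point :: "'a \<Rightarrow> 'a \<Rightarrow> nat \<Rightarrow> nat \<Rightarrow> nat \<Rightarrow> 'a" where
  "point a b k i = (\<lambda>j\<in>{1..k}. if j = i then a else b)"

text \<open>The support is written as an image of \<open>point\<close> rather than by counting
  entries, so that a tuple in it comes with the position of its entry \<open>a\<close>.\<close>

definition exactly_one ::
    "'a set \<Rightarrow> 'a \<Rightarrow> 'a \<Rightarrow> 'b \<Rightarrow> 'b \<Rightarrow> nat \<Rightarrow> (nat \<Rightarrow> 'a) \<Rightarrow> 'b" where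
  "exactly_one A a b c d k = (\<lambda>x\<in>tuples A k. if x \<in> point a b k ` {1..k} then c else d)"

lemma point_in_tuples:
  assumes "a \<in> A" and "b \<in> A"
  shows "point a b k i \<in> tuples A k"
  using assms by (auto simp: point_def tuples_def)

lemma minor_exactly_one_eq:
  assumes "a \<in> A" and "b \<in> A" and "a \<noteq> b" and "c \<noteq> d"
    and \<sigma>: "\<sigma> \<in> {1..k} \<rightarrow> {1..l}"
    and eq: "minor A k l \<sigma> (exactly_one A a b c d k) = exactly_one A a b c d l"
  shows "k = l"
proof -
  have fibre: "\<exists>j\<in>{1..k}. \<forall>j'\<in>{1..k}. \<sigma> j' = i \<longleftrightarrow> j' = j" if i: "i \<in> {1..l}" for i
  proof -
    have pt: "point a b l i \<in> tuples A l"
      using assms(1,2) by (rule point_in_tuples)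
    \<comment> \<open>The tuple \<open>point a b l i\<close> lies in the support of the right-hand
      side of \<open>eq\<close>.\<close>
    have "exactly_one A a b c d k (compose {1..k} (point a b l i) \<sigma>) = c"
      using fun_cong[OF eq, of "point a b l i"] pt i
      by (simp add: minor_def exactly_one_def)
    then obtain j where j: "j \<in> {1..k}"
      and comp: "compose {1..k} (point a b l i) \<sigma> = point a b k j"
      using compose_in_tuples[OF pt \<sigma>] \<open>c \<noteq> d\<close>
      by (auto simp: exactly_one_def split: if_splits)
    \<comment> \<open>Compare the entries at \<open>j'\<close>: the left one is \<open>a\<close> iff
      \<open>\<sigma> j' = i\<close>, the right one iff \<open>j' = j\<close>.\<close>
    have "\<sigma> j' = i \<longleftrightarrow> j' = j" if j': "j' \<in> {1..k}" for j'
      using fun_cong[OF comp, of j'] j' funcset_mem[OF \<sigma> j'] \<open>a \<noteq> b\<close>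
      by (auto simp: compose_def point_def split: if_splits)
    with j show ?thesis by blast
  qed
  \<comment> \<open>Uniqueness of \<open>j\<close> in each fibre gives injectivity, existence gives
    surjectivity.\<close>
  have "inj_on \<sigma> {1..k}"
    using fibre funcset_mem[OF \<sigma>] by (metis inj_onI)
  moreover have "\<sigma> ` {1..k} = {1..l}"
    using fibre \<sigma> by fast
  ultimately have "card {1..k} = card {1..l}"
    by (metis card_image)
  then show ?thesis by simp
qed

lemma exactly_one_in_operations:
  assumes "c \<in> B" and "d \<in> B" and "k \<ge> 1"
  shows "(k, exactly_one A a b c d k) \<in> operations A B"
  using assms by (auto simp: operations_def exactly_one_def)

lemma exactly_one_in_minors_iff:
  assumes "a \<in> A" and "b \<in> A" and "a \<noteq> b" and "c \<noteq> d" and "l \<ge> 1"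
  shows "(l, exactly_one A a b c d l) \<in> minors A ((\<lambda>k. (k, exactly_one A a b c d k)) ` S) \<longleftrightarrow> l \<in> S"
    (is "?lhs \<longleftrightarrow> _")
proof
  assume ?lhs
  then obtain k \<sigma> where "k \<in> S" "\<sigma> \<in> {1..k} \<rightarrow> {1..l}"
    "minor A k l \<sigma> (exactly_one A a b c d k) = exactly_one A a b c d l"
    by (auto simp: minors_def)
  with assms(1-4) minor_exactly_one_eq show "l \<in> S" by metis
next
  assume "l \<in> S"
  \<comment> \<open>No target set is fixed here; \<open>{c, d}\<close> serves as one.\<close>
  moreover have "exactly_one A a b c d l = minor A l l id (exactly_one A a b c d l)"
    using minor_id[OF exactly_one_in_operations[of c "{c, d}" d l A a b]] \<open>l \<ge> 1\<close> by simp
  moreover have "id \<in> {1..l} \<rightarrow> {1..l}" by simp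
  ultimately show ?lhs
    using \<open>l \<ge> 1\<close> unfolding minors_def by blast
qed

theorem clonoids_eqpoll_reals:
  assumes "finite A" and "finite B" and "a \<in> A" "b \<in> A" "a \<noteq> b" and "c \<in> B" "d \<in> B" "c \<noteq> d"
  shows "{C. clonoid A B C} \<approx> (UNIV :: real set)"
proof -
  \<comment> \<open>Arities start at 1 while \<open>nat\<close> starts at 0, hence the shift by
    \<open>Suc\<close>.\<close>
  let ?G = "\<lambda>S. minors A ((\<lambda>k. (k, exactly_one A a b c d k)) ` Suc ` S)"
  have "{C. clonoid A B C} \<lesssim> Pow (operations A B)"
    by (rule subset_imp_lepoll) (auto simp: clonoid_def)
  also have "\<dots> \<lesssim> (UNIV :: nat set set)"
  proof -
    have "inj_on (image (to_nat_on (operations A B))) (Pow (operations A B))"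
      using countable_operations[OF assms(1,2)]
      by (intro inj_on_image_Pow inj_on_to_nat_on)
    then show ?thesis
      unfolding lepoll_def by blast
  qed
  finally have upper: "{C. clonoid A B C} \<lesssim> (UNIV :: nat set set)" .
  \<comment> \<open>The set \<open>S\<close> can be read off from \<open>?G S\<close>, which makes
    \<open>?G\<close> injective.\<close>
  have "k \<in> S \<longleftrightarrow> (Suc k, exactly_one A a b c d (Suc k)) \<in> ?G S" for k S
    using exactly_one_in_minors_iff[OF assms(3-5,8), of "Suc k" "Suc ` S"] by auto
  then have "inj ?G"
    by (intro injI set_eqI) metis
  moreover have "clonoid A B (?G S)" for S
    using assms(6,7) by (intro clonoid_minors) (auto intro: exactly_one_in_operations)
  ultimately have "(UNIV :: nat set set) \<lesssim> {C. clonoid A B C}"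
    unfolding lepoll_def by blast
  with upper have "{C. clonoid A B C} \<approx> (UNIV :: nat set set)"
    by (rule lepoll_antisym)
  then show ?thesis
    using nat_sets_eqpoll_reals by (rule eqpoll_trans)
qed

theorem corollary1p6:
  fixes m n :: nat
  assumes "m \<ge> 1" and "n \<ge> 1"
  shows "{C. clonoid {0..m} {0..n} C} \<approx> (UNIV :: real set)"
  \<comment> \<open>As \<open>m\<close> and \<open>n\<close> are at least 1, the elements 0 and 1
    lie in both sets.\<close>
  using assms by (intro clonoids_eqpoll_reals[where a = 1 and b = 0 and c = 1 and d = 0]) auto

end
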